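(* Let $X$ be a finite dimensional linear 2-normed space over $\mathbb{K}$ ($\mathbb{K}=\mathbb{R}$ or $\mathbb{C}$) and let $b\in X$ be fixed. Then every b-linear functional defined on $X\times\langle b\rangle$ is b-sequentially continuous.
   Context: Let $X$ be a linear space of dimension greater than $1$ over $\mathbb{K}$. A 2-norm on $X$ is a function $\|\cdot,\cdot\|:X\times X\to\mathbb{R}$ such that: (N1) $\|x,y\|=0$ if and only if $x,y$ are linearly dependent; (N2) $\|x,y\|=\|y,x\|$; (N3) $\|\alpha x,y\|=|\alpha|\,\|x,y\|$ for all $\alpha\in\mathbb{K}$; (N4) $\|x,y+z\|\le\|x,y\|+\|x,z\|$. The pair $(X,\|\cdot,\cdot\|)$ is then called a linear 2-normed space. A sequence $\{x_n\}$ in $X$ converges to $x\in X$ if $\lim_{n\to\infty}\|x_n-x,y\|=0$ for every $y\in X$. For fixed $b\in X$, $\langle b\rangle$ is the subspace of $X$ generated by $b$. A b-linear functional on $X\times\langle b\rangle$ is a map $T:X\times\langle b\rangle\to\mathbb{K}$ with $T(x+y,b)=T(x,b)+T(y,b)$ and $T(kx,b)=kT(x,b)$ for all $x,y\in X$, $k\in\mathbb{K}$. A b-linear functional $T$ on $X\times\langle b\rangle$ is b-sequentially continuous at $x\in X$ if for every sequence $\{x_n\}$ converging to $x$ in $X$, the sequence $\{T(x_n,b)\}$ converges to $T(x,b)$ in $\mathbb{K}$; it is b-sequentially continuous if this holds at every $x\in X$. *)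

theory Defs
  imports Complex_Main
begin

text \<open>
  Linear dependence of the pair (family) \<open>x, y\<close>. This is not dependence of the set \<open>{x, y}\<close>,
  which would wrongly make \<open>x, x\<close> independent for nonzero \<open>x\<close>.
\<close>

definition lin_dep_pair :: "('k::field \<Rightarrow> 'a::ab_group_add \<Rightarrow> 'a) \<Rightarrow> 'a \<Rightarrow> 'a \<Rightarrow> bool"
  where "lin_dep_pair scale x y \<longleftrightarrow>
    (\<exists>c d. (c \<noteq> 0 \<or> d \<noteq> 0) \<and> scale c x + scale d y = 0)"

text \<open>
  The scalar field is meant to be \<open>real\<close> or \<open>complex\<close>, where \<open>norm\<close> is the absolute value.
  The space may be infinite dimensional here. As \<open>card\<close> and \<open>dim\<close> are then 0, the
  requirement that the dimension exceeds 1 is put on a basis.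
\<close>

locale linear_2_normed_space = vector_space scale
  for scale :: "'k::real_normed_field \<Rightarrow> 'a::ab_group_add \<Rightarrow> 'a" +
  fixes norm2 :: "'a \<Rightarrow> 'a \<Rightarrow> real"
  assumes dim_gt_1: "\<exists>B. independent B \<and> span B = UNIV \<and> (infinite B \<or> card B > 1)"
    and norm2_eq_0_iff: "norm2 x y = 0 \<longleftrightarrow> lin_dep_pair scale x y"
    and norm2_commute: "norm2 x y = norm2 y x"
    and norm2_scale: "norm2 (scale \<alpha> x) y = norm \<alpha> * norm2 x y"
    and norm2_triangle: "norm2 x (y + z) \<le> norm2 x y + norm2 x z"

definition converges2 ::
    "('a::ab_group_add \<Rightarrow> 'a \<Rightarrow> real) \<Rightarrow> (nat \<Rightarrow> 'a) \<Rightarrow> 'a \<Rightarrow> bool"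
  where "converges2 norm2 X x \<longleftrightarrow> (\<forall>y. (\<lambda>n. norm2 (X n - x) y) \<longlonglongrightarrow> 0)"

text \<open>
  A functional on \<open>UNIV \<times> span {b}\<close> is represented by a total function on pairs.
  The definitions below inspect it only at pairs \<open>(x, b)\<close>, so its values outside
  that domain play no role.
\<close>

definition b_linear_functional ::
    "('k::field \<Rightarrow> 'a::ab_group_add \<Rightarrow> 'a) \<Rightarrow> 'a \<Rightarrow> ('a \<times> 'a \<Rightarrow> 'k) \<Rightarrow> bool"
  where "b_linear_functional scale b T \<longleftrightarrow>
    (\<forall>x y. T (x + y, b) = T (x, b) + T (y, b)) \<and>
    (\<forall>k x. T (scale k x, b) = k * T (x, b))"

definition b_seq_continuous_at ::
    "('a::ab_group_add \<Rightarrow> 'a \<Rightarrow> real) \<Rightarrow> 'a \<Rightarrow> ('a \<times> 'a \<Rightarrow> 'k::real_normed_field) \<Rightarrow> 'a \<Rightarrow> bool"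
  where "b_seq_continuous_at norm2 b T x \<longleftrightarrow>
    (\<forall>X. converges2 norm2 X x \<longrightarrow> (\<lambda>n. T (X n, b)) \<longlonglongrightarrow> T (x, b))"

definition b_seq_continuous ::
    "('a::ab_group_add \<Rightarrow> 'a \<Rightarrow> real) \<Rightarrow> 'a \<Rightarrow> ('a \<times> 'a \<Rightarrow> 'k::real_normed_field) \<Rightarrow> bool"
  where "b_seq_continuous norm2 b T \<longleftrightarrow> (\<forall>x. b_seq_continuous_at norm2 b T x)"

end

theory Submission
  imports Defs "HOL-Analysis.Analysis"
begin

text \<open>
  Summing \<open>\<parallel>x, e\<parallel>\<close> over a finite basis gives a norm on \<open>X\<close>: if it vanishes at
  \<open>x \<noteq> 0\<close>, every basis vector is a multiple of \<open>x\<close>, so the dimension is at most 1. Hence, as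
  for any norm in finite dimension, it dominates the sum of the moduli of the coordinates, which
  in turn dominates every linear functional.
\<close>

text \<open>
  By compactness of the unit sphere of the coordinate norm. The coordinates range over total
  functions, to which Tychonoff's theorem applies, although only their values on \<open>B\<close> matter.
\<close>

lemma norm_dominates_coordinates:
  fixes scale :: "'k::{real_normed_field,heine_borel} \<Rightarrow> 'a::ab_group_add \<Rightarrow> 'a"
    and p :: "'a \<Rightarrow> real"
  assumes vs: "vector_space scale"
    and fin: "finite B" and indep: "\<not> module.dependent scale B"
    and add: "\<And>x y. p (x + y) \<le> p x + p y"
    and hom: "\<And>k x. p (scale k x) = norm k * p x"
    and definite: "\<And>x. p x = 0 \<Longrightarrow> x = 0"
  obtains m where "m > 0"
    "\<And>c. m * (\<Sum>e\<in>B. norm (c e)) \<le> p (\<Sum>e\<in>B. scale (c e) e)"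
proof -
  interpret vector_space scale by (fact vs)
  have p0: "p 0 = 0" using hom[of 0 0] by simp
  have pminus: "p (- x) = p x" for x using hom[of "-1" x] by simp
  have nonneg: "p x \<ge> 0" for x using add[of x "- x"] pminus[of x] p0 by simp
  have psum: "p (\<Sum>e\<in>A. f e) \<le> (\<Sum>e\<in>A. p (f e))" if "finite A" for A and f :: "'a \<Rightarrow> 'a"
    using that
  proof (induction A rule: finite_induct)
    case (insert a A)
    then show ?case using add[of "f a" "sum f A"] by simp
  qed (simp add: p0)
  define L where "L c = (\<Sum>e\<in>B. scale (c e) e)" for c
  define s where "s c = (\<Sum>e\<in>B. norm (c e))" for c :: "'a \<Rightarrow> 'k"
  \<comment> \<open>The condition \<open>s c = 1\<close> leaves the coordinates outside
    \<open>B\<close> free. Intersecting with a product of closed unit balls confines them too, so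
    that \<open>K\<close> is compact.\<close>
  define K where "K = (UNIV \<rightarrow>\<^sub>E cball (0::'k) 1) \<inter> {c. s c = 1}"
  have Ldiff: "L c - L d = (\<Sum>e\<in>B. scale (c e - d e) e)" for c d
    by (simp add: L_def scale_left_diff_distrib sum_subtractf)
  \<comment> \<open>A reverse triangle inequality. Its right side involves only finitely many
    coordinates, so it makes \<open>p (L c)\<close> continuous in \<open>c\<close> for the product
    topology.\<close>
  have bound: "\<bar>p (L c) - p (L d)\<bar> \<le> (\<Sum>e\<in>B. norm (c e - d e) * p e)" for c d
  proof -
    have "p (L c) \<le> p (L c - L d) + p (L d)" using add[of "L c - L d" "L d"] by simp
    moreover have "p (L d) \<le> p (L c - L d) + p (L c)"
      using add[of "- (L c - L d)" "L c"] pminus[of "L c - L d"] by simp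
    moreover have "p (L c - L d) \<le> (\<Sum>e\<in>B. norm (c e - d e) * p e)"
      unfolding Ldiff using psum[OF fin, of "\<lambda>e. scale (c e - d e) e"] by (simp add: hom)
    ultimately show ?thesis by linarith
  qed
  have coord: "continuous_on A (\<lambda>c::'a \<Rightarrow> 'k. c e)" for A e
    by (rule continuous_on_subset[OF continuous_on_product_coordinates]) simp
  have cont: "continuous_on A (\<lambda>c. p (L c))" for A
    unfolding continuous_on_def
  proof
    fix d assume "d \<in> A"
    then have "((\<lambda>c. c e) \<longlongrightarrow> d e) (at d within A)" for e
      using coord[of A e] by (simp add: continuous_on_def)
    then have "((\<lambda>c. \<Sum>e\<in>B. norm (c e - d e) * p e) \<longlongrightarrow> (\<Sum>e\<in>B. norm (d e - d e) * p e)) (at d within A)"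
      by (intro tendsto_intros)
    then have "((\<lambda>c. \<Sum>e\<in>B. norm (c e - d e) * p e) \<longlongrightarrow> 0) (at d within A)"
      by simp
    then have "((\<lambda>c. p (L c) - p (L d)) \<longlongrightarrow> 0) (at d within A)"
      by (rule Lim_null_comparison[rotated]) (simp add: bound)
    then show "((\<lambda>c. p (L c)) \<longlongrightarrow> p (L d)) (at d within A)"
      by (simp add: LIM_zero_iff)
  qed
  have "compact (UNIV \<rightarrow>\<^sub>E cball (0::'k) 1 :: ('a \<Rightarrow> 'k) set)"
    using compactin_PiE[of "\<lambda>_::'a. euclidean :: 'k topology" UNIV "\<lambda>_. cball 0 1"]
    by (simp add: euclidean_product_topology)
  moreover have "closed {c. s c = 1}"
    unfolding s_def
    by (intro closed_Collect_eq continuous_on_sum continuous_on_norm coord continuous_on_const)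
  ultimately have "compact K" unfolding K_def by (rule compact_Int_closed)
  have pos: "p (L c) > 0" if "s c = 1" for c
  proof -
    have "L c \<noteq> 0"
    proof
      assume "L c = 0"
      then have "c e = 0" if "e \<in> B" for e
        using independentD[OF indep fin order_refl _ that] unfolding L_def by blast
      then have "s c = 0" by (simp add: s_def)
      with that show False by simp
    qed
    then have "p (L c) \<noteq> 0" using definite by blast
    then show ?thesis using nonneg[of "L c"] by simp
  qed
  \<comment> \<open>The minimum of \<open>p (L c)\<close> on \<open>K\<close>, positive by
    \<open>pos\<close>. \<open>K\<close> is empty exactly when \<open>B\<close> is, and then any
    positive \<open>m\<close> serves.\<close>
  obtain m where m: "m > 0" "\<And>c. c \<in> K \<Longrightarrow> m \<le> p (L c)"
  proof (cases "K = {}")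
    case True
    then show ?thesis using that[of 1] by simp
  next
    case False
    then obtain d where "d \<in> K" "\<And>c. c \<in> K \<Longrightarrow> p (L d) \<le> p (L c)"
      using continuous_attains_inf[OF \<open>compact K\<close> _ cont] by blast
    then show ?thesis using that[of "p (L d)"] pos[of d] by (simp add: K_def)
  qed
  have "m * s c \<le> p (L c)" for c
  proof (cases "s c = 0")
    case True
    then show ?thesis by (simp add: nonneg)
  next
    case False
    then have sc: "s c > 0" unfolding s_def by (simp add: sum_nonneg order_less_le)
    define k :: 'k where "k = of_real (1 / s c)"
    have nk: "norm k = 1 / s c" using sc by (simp add: k_def norm_divide)
    \<comment> \<open>Normalising \<open>c\<close> to \<open>s d = 1\<close> reduces the claim to
      \<open>K\<close>. The value 0 outside \<open>B\<close> keeps \<open>d\<close> in the product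
      of balls and changes neither \<open>s\<close> nor \<open>L\<close>.\<close>
    define d where "d e = (if e \<in> B then k * c e else 0)" for e
    have "s d = norm k * s c"
      by (simp add: s_def d_def norm_mult sum_distrib_left)
    with nk sc have sd: "s d = 1" by simp
    have "norm (d e) \<le> 1" for e
    proof (cases "e \<in> B")
      case True
      then show ?thesis
        using member_le_sum[OF True, of "\<lambda>e. norm (d e)"] fin sd by (simp add: s_def)
    qed (simp add: d_def)
    with sd have "d \<in> K" by (auto simp: K_def)
    have "L d = scale k (L c)"
      by (simp add: L_def d_def scale_sum_right)
    then have "p (L d) = p (L c) / s c" by (simp add: hom nk)
    with m(2)[OF \<open>d \<in> K\<close>] sc show ?thesis by (simp add: field_simps)
  qed
  with m(1) show ?thesis using that unfolding s_def L_def by blast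
qed

context linear_2_normed_space
begin

lemma norm2_zero_right: "norm2 x 0 = 0"
  using norm2_scale[of 0 0 x] by (simp add: norm2_commute)

lemma norm2_minus_right: "norm2 x (- y) = norm2 x y"
  using norm2_scale[of "-1" y x] by (simp add: norm2_commute)

text \<open>Not an axiom: subadditivity applied to \<open>y\<close> and \<open>- y\<close> gives
  \<open>0 \<le> 2 * norm2 x y\<close>.\<close>

lemma norm2_nonneg: "norm2 x y \<ge> 0"
  using norm2_triangle[of x y "- y"] by (simp add: norm2_zero_right norm2_minus_right)

text \<open>This is where \<open>dim_gt_1\<close> enters: on a line any two vectors are dependent,
  so \<open>norm2\<close> would vanish identically.\<close>

lemma norm2_definite:
  assumes span: "span B = UNIV" and zero: "\<And>e. e \<in> B \<Longrightarrow> norm2 x e = 0"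
  shows "x = 0"
proof (rule ccontr)
  assume "x \<noteq> 0"
  have "e \<in> span {x}" if e: "e \<in> B" for e
  proof -
    obtain c d where cd: "c \<noteq> 0 \<or> d \<noteq> 0" "scale c x + scale d e = 0"
      using zero[OF e] unfolding norm2_eq_0_iff lin_dep_pair_def by blast
    \<comment> \<open>If \<open>d = 0\<close>, then \<open>c \<noteq> 0\<close> and
      \<open>scale c x = 0\<close>, which forces \<open>x = 0\<close>.\<close>
    with \<open>x \<noteq> 0\<close> have "d \<noteq> 0" by auto
    have "scale d e = scale (- c) x" using cd(2) by (simp add: eq_neg_iff_add_eq_0 add.commute)
    then have "scale (inverse d) (scale d e) = scale (inverse d) (scale (- c) x)" by simp
    then have "e = scale (inverse d * (- c)) x" using \<open>d \<noteq> 0\<close> by simp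
    then show ?thesis by (metis span_base span_scale singletonI)
  qed
  then have "span B \<subseteq> span {x}" by (intro span_minimal) auto
  then have *: "A \<subseteq> span {x}" for A using span by auto
  obtain A where "independent A" "infinite A \<or> card A > 1" using dim_gt_1 by blast
  with independent_span_bound[OF _ _ *, of A] show False by simp
qed

end

text \<open>The sort of \<open>'k\<close> treats \<open>real\<close> and \<open>complex\<close>
  together; \<open>heine_borel\<close> supplies the compact balls of scalars.\<close>

lemma b_linear_functional_seq_continuous:
  fixes scale :: "'k::{real_normed_field,heine_borel} \<Rightarrow> 'a::ab_group_add \<Rightarrow> 'a"
  assumes "linear_2_normed_space scale norm2"
    and "finite_dimensional_vector_space scale B"
    and T: "b_linear_functional scale b T"
  shows "b_seq_continuous norm2 b T"
proof -
  interpret linear_2_normed_space scale norm2 by fact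
  interpret fd: finite_dimensional_vector_space scale B by fact
  note fin = fd.finite_Basis
  define f where "f x = T (x, b)" for x
  have f_add: "f (x + y) = f x + f y" and f_scale: "f (scale k x) = k * f x" for x y k
    using T by (auto simp: b_linear_functional_def f_def)
  have f0: "f 0 = 0" using f_add[of 0 0] by simp
  have f_diff: "f (x - y) = f x - f y" for x y
    using f_add[of "x - y" y] by simp
  have f_sum: "f (\<Sum>e\<in>A. g e) = (\<Sum>e\<in>A. f (g e))" for A and g :: "'a \<Rightarrow> 'a"
    by (induction A rule: infinite_finite_induct) (simp_all add: f0 f_add)
  define p where "p x = (\<Sum>e\<in>B. norm2 x e)" for x
  obtain m where m: "m > 0"
    "\<And>c. m * (\<Sum>e\<in>B. norm (c e)) \<le> p (\<Sum>e\<in>B. scale (c e) e)"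
  proof (rule norm_dominates_coordinates[OF vector_space_axioms fin fd.independent_Basis, of p])
    show "p (x + y) \<le> p x + p y" for x y
      unfolding p_def sum.distrib[symmetric]
      by (intro sum_mono) (metis norm2_commute norm2_triangle)
    show "p (scale k x) = norm k * p x" for k x
      by (simp add: p_def norm2_scale sum_distrib_left)
    show "x = 0" if "p x = 0" for x
      using that norm2_definite[OF fd.span_Basis]
      by (simp add: p_def sum_nonneg_eq_0_iff[OF fin] norm2_nonneg)
  qed blast
  \<comment> \<open>Bounds every \<open>norm (f e)\<close> at once, so \<open>M / m\<close> is a
    Lipschitz constant of \<open>f\<close> for the norm \<open>p\<close>.\<close>
  define M where "M = (\<Sum>e\<in>B. norm (f e))"
  have f_bound: "norm (f x) \<le> M / m * p x" for x
  proof -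
    define c where "c = representation B x"
    have x: "(\<Sum>e\<in>B. scale (c e) e) = x"
      unfolding c_def
      by (rule sum_representation_eq) (simp_all add: fd.independent_Basis fd.span_Basis fin)
    have "norm (f x) = norm (\<Sum>e\<in>B. c e * f e)"
      by (subst x[symmetric]) (simp add: f_sum f_scale)
    also have "\<dots> \<le> (\<Sum>e\<in>B. norm (c e) * norm (f e))"
      by (rule order_trans[OF norm_sum]) (simp add: norm_mult)
    also have "\<dots> \<le> (\<Sum>e\<in>B. norm (c e) * M)"
      unfolding M_def by (intro sum_mono mult_left_mono member_le_sum) (simp_all add: fin)
    also have "\<dots> = M * (\<Sum>e\<in>B. norm (c e))" by (simp add: sum_distrib_left mult.commute)
    also have "\<dots> \<le> M * (p x / m)"
      using m(2)[of c] m(1) unfolding x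
      by (intro mult_left_mono) (simp_all add: M_def sum_nonneg field_simps)
    finally show ?thesis by simp
  qed
  show ?thesis
    unfolding b_seq_continuous_def b_seq_continuous_at_def
  proof (intro allI impI)
    fix x X assume "converges2 norm2 X x"
    \<comment> \<open>Convergence is tested only against the finitely many \<open>y\<close> in
      \<open>B\<close>, which already gives convergence in the norm \<open>p\<close>.\<close>
    then have "(\<lambda>n. M / m * p (X n - x)) \<longlonglongrightarrow> M / m * (\<Sum>e\<in>B. 0)"
      unfolding p_def converges2_def by (intro tendsto_intros) auto
    then have "(\<lambda>n. M / m * p (X n - x)) \<longlonglongrightarrow> 0" by simp
    then have "(\<lambda>n. f (X n) - f x) \<longlonglongrightarrow> 0"
      by (rule Lim_null_comparison[rotated]) (use f_bound in \<open>simp flip: f_diff\<close>)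
    then show "(\<lambda>n. T (X n, b)) \<longlonglongrightarrow> T (x, b)"
      by (simp add: LIM_zero_iff f_def)
  qed
qed

theorem theorem4p8:
  shows "(\<forall>(scale :: real \<Rightarrow> 'a::ab_group_add \<Rightarrow> 'a) norm2 b T.
            linear_2_normed_space scale norm2 \<longrightarrow>
            (\<exists>Basis. finite_dimensional_vector_space scale Basis) \<longrightarrow>
            b_linear_functional scale b T \<longrightarrow>
            b_seq_continuous norm2 b T)
       \<and> (\<forall>(scale :: complex \<Rightarrow> 'a::ab_group_add \<Rightarrow> 'a) norm2 b T.
            linear_2_normed_space scale norm2 \<longrightarrow>
            (\<exists>Basis. finite_dimensional_vector_space scale Basis) \<longrightarrow>
            b_linear_functional scale b T \<longrightarrow>
            b_seq_continuous norm2 b T)"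
  by (intro conjI allI impI; elim exE; rule b_linear_functional_seq_continuous)

end
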